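(* Consider the vacuum pp-wave with $f(\zeta,u)=e^{4A(u)}\zeta^2$, where $A=A(u)$ is a complex-valued function, and suppose that $\Delta\gamma=0$ and $\operatorname{Re}\gamma=0$. Then, without loss of generality (i.e. after a form-preserving change of coordinates), $$f(\zeta,u)=e^{2ik_0u}\,\zeta^2,$$ where $k_0$ is a real constant.
   Context: Setting. Everything is local, on a small connected coordinate domain with coordinates $(\zeta,\bar\zeta,u,v)$, $\zeta$ complex, $u,v$ real; $^*$ (or a bar) is complex conjugation. A (non-flat) vacuum pp-wave is a metric $ds^2=2\,d\zeta\,d\bar\zeta-2\,du\,dv-2(f+\bar f)\,du^2$ with $f=f(\zeta,u)$ complex analytic in $\zeta$, smooth in $u$, $f_{\zeta\zeta}\neq0$. ($f$ matters only modulo adding a purely imaginary function of $u$.) Form-preserving coordinate changes: $\hat\zeta=e^{i\kappa}(\zeta+b(u))$, $\hat u=(u+u_0)/c$, $\hat v=c\,(v+b'(u)\bar\zeta+\bar b'(u)\zeta+m(u))$, $\hat f=c^2\big(f-\bar b''(u)\zeta+\tfrac12(b'\bar b'-m'(u))\big)$ with $\kappa,u_0,c\neq0$ real constants, $b$ complex-valued, $m$ real-valued. For $f=e^{4A(u)}\zeta^2$, in any null tetrad aligned with the covariantly constant null vector and normalized by $\Psi_4=1$, the Newman–Penrose spin coefficient $\alpha$ vanishes and $\gamma=\frac{1}{\sqrt2}e^{-2\operatorname{Re}A}\,(A_u)^*$, a function of $u$; on functions of $u$ the tetrad derivative is $\Delta=\frac1{\sqrt2}e^{-2\operatorname{Re}A}\,\frac{d}{du}$,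 so $\Delta\gamma=0$ means that $\gamma$ is constant. *)

theory Defs
  imports "HOL-Analysis.Analysis"
begin

section \<open>Smooth functions and coordinate derivatives\<close>

definition dir_deriv :: "'a::real_normed_vector \<Rightarrow> ('a \<Rightarrow> 'b::real_normed_vector) \<Rightarrow> 'a \<Rightarrow> 'b"
  where "dir_deriv w F = (\<lambda>p. frechet_derivative F (at p) w)"

text \<open>Infinite differentiability; meant for open sets in finite-dimensional spaces, where it is
  equivalent to all iterated directional derivatives being differentiable.\<close>

definition smooth_on :: "'a::real_normed_vector set \<Rightarrow> ('a \<Rightarrow> 'b::real_normed_vector) \<Rightarrow> bool"
  where "smooth_on S F \<longleftrightarrow> (\<forall>ws. fold dir_deriv ws F differentiable_on S)"

text \<open>A point is \<open>(\<zeta>, u, v)\<close>. Tensors are complexified and are given by their components in the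
  coordinates \<open>(\<zeta>, cnj \<zeta>, u, v)\<close>, indexed by \<open>1, 2, 3, 4\<close> in this order. Accordingly
  \<open>partial 1\<close> and \<open>partial 2\<close> are the Wirtinger derivatives.\<close>

type_synonym point = "complex \<times> real \<times> real"
type_synonym vector_field = "point \<Rightarrow> complex ^ 4"
type_synonym metric = "point \<Rightarrow> complex ^ 4 ^ 4"

definition partial :: "4 \<Rightarrow> (point \<Rightarrow> complex) \<Rightarrow> point \<Rightarrow> complex"
  where "partial i F p =
    (if i = 1 then (dir_deriv (1, 0, 0) F p - \<i> * dir_deriv (\<i>, 0, 0) F p) / 2
     else if i = 2 then (dir_deriv (1, 0, 0) F p + \<i> * dir_deriv (\<i>, 0, 0) F p) / 2
     else if i = 3 then dir_deriv (0, 1, 0) F p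
     else dir_deriv (0, 0, 1) F p)"

text \<open>Complex conjugation of complexified vectors exchanges the \<open>\<zeta>\<close> and \<open>cnj \<zeta>\<close> components;
  the real vectors are the fixed points.\<close>

definition conj_vec :: "complex ^ 4 \<Rightarrow> complex ^ 4"
  where "conj_vec X = (\<chi> i. cnj (X $ (if i = 1 then 2 else if i = 2 then 1 else i)))"

definition smooth_vector_field :: "point set \<Rightarrow> vector_field \<Rightarrow> bool"
  where "smooth_vector_field D X \<longleftrightarrow> (\<forall>i. smooth_on D (\<lambda>p. X p $ i))"


section \<open>Levi-Civita connection and curvature of a metric\<close>

definition inner_prod :: "metric \<Rightarrow> point \<Rightarrow> complex ^ 4 \<Rightarrow> complex ^ 4 \<Rightarrow> complex"
  where "inner_prod g p X Y = (\<Sum>i\<in>UNIV. \<Sum>j\<in>UNIV. g p $ i $ j * X $ i * Y $ j)"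

definition christoffel :: "metric \<Rightarrow> point \<Rightarrow> 4 \<Rightarrow> 4 \<Rightarrow> 4 \<Rightarrow> complex"
  where "christoffel g p a b c =
    (\<Sum>d\<in>UNIV. matrix_inv (g p) $ a $ d *
       (partial b (\<lambda>q. g q $ d $ c) p + partial c (\<lambda>q. g q $ d $ b) p
        - partial d (\<lambda>q. g q $ b $ c) p)) / 2"

text \<open>\<open>cov_deriv g X Y\<close> is the covariant derivative of \<open>Y\<close> in the direction \<open>X\<close>.\<close>

definition cov_deriv :: "metric \<Rightarrow> vector_field \<Rightarrow> vector_field \<Rightarrow> vector_field"
  where "cov_deriv g X Y p =
    (\<chi> a. \<Sum>b\<in>UNIV. X p $ b *
       (partial b (\<lambda>q. Y q $ a) p + (\<Sum>c\<in>UNIV. christoffel g p a b c * Y p $ c)))"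

text \<open>\<open>riemann_up g p a b c d\<close> has the index \<open>a\<close> upstairs, and \<open>c, d\<close> are the form indices.\<close>

definition riemann_up :: "metric \<Rightarrow> point \<Rightarrow> 4 \<Rightarrow> 4 \<Rightarrow> 4 \<Rightarrow> 4 \<Rightarrow> complex"
  where "riemann_up g p a b c d =
    partial c (\<lambda>q. christoffel g q a d b) p - partial d (\<lambda>q. christoffel g q a c b) p
    + (\<Sum>e\<in>UNIV. christoffel g p a c e * christoffel g p e d b
                - christoffel g p a d e * christoffel g p e c b)"

definition riemann :: "metric \<Rightarrow> point \<Rightarrow> 4 \<Rightarrow> 4 \<Rightarrow> 4 \<Rightarrow> 4 \<Rightarrow> complex"
  where "riemann g p a b c d = (\<Sum>e\<in>UNIV. g p $ a $ e * riemann_up g p e b c d)"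

definition ricci :: "metric \<Rightarrow> point \<Rightarrow> 4 \<Rightarrow> 4 \<Rightarrow> complex"
  where "ricci g p b d = (\<Sum>a\<in>UNIV. riemann_up g p a b a d)"

definition scalar_curvature :: "metric \<Rightarrow> point \<Rightarrow> complex"
  where "scalar_curvature g p =
    (\<Sum>b\<in>UNIV. \<Sum>d\<in>UNIV. matrix_inv (g p) $ b $ d * ricci g p b d)"

definition weyl :: "metric \<Rightarrow> point \<Rightarrow> 4 \<Rightarrow> 4 \<Rightarrow> 4 \<Rightarrow> 4 \<Rightarrow> complex"
  where "weyl g p a b c d =
    riemann g p a b c d
    - (g p $ a $ c * ricci g p b d - g p $ a $ d * ricci g p b c
       - g p $ b $ c * ricci g p a d + g p $ b $ d * ricci g p a c) / 2
    + scalar_curvature g p / 6 * (g p $ a $ c * g p $ b $ d - g p $ a $ d * g p $ b $ c)"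


section \<open>Null tetrads and Newman--Penrose quantities\<close>

text \<open>Signature \<open>(+,+,+,-)\<close>: the tetrad \<open>(m, conj m, l, k)\<close> has \<open>k\<close>, \<open>l\<close> real null,
  \<open>k \<cdot> l = -1\<close> and \<open>m \<cdot> conj m = 1\<close>.\<close>

definition null_tetrad ::
  "metric \<Rightarrow> point set \<Rightarrow> vector_field \<Rightarrow> vector_field \<Rightarrow> vector_field \<Rightarrow> bool"
  where "null_tetrad g D k l m \<longleftrightarrow>
    smooth_vector_field D k \<and> smooth_vector_field D l \<and> smooth_vector_field D m \<and>
    (\<forall>p\<in>D. conj_vec (k p) = k p \<and> conj_vec (l p) = l p \<and>
      inner_prod g p (k p) (k p) = 0 \<and> inner_prod g p (l p) (l p) = 0 \<and>
      inner_prod g p (m p) (m p) = 0 \<and>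
      inner_prod g p (k p) (l p) = -1 \<and> inner_prod g p (m p) (conj_vec (m p)) = 1 \<and>
      inner_prod g p (k p) (m p) = 0 \<and> inner_prod g p (l p) (m p) = 0)"

text \<open>The directional derivative \<open>\<Delta> = l\<^sup>a \<partial>\<^sub>a\<close>.\<close>

definition NP_Delta :: "vector_field \<Rightarrow> (point \<Rightarrow> complex) \<Rightarrow> point \<Rightarrow> complex"
  where "NP_Delta l F p = (\<Sum>a\<in>UNIV. l p $ a * partial a F p)"

text \<open>The spin coefficient \<open>- \<gamma> = (k\<^sub>a\<^sub>;\<^sub>b l\<^sup>a l\<^sup>b - m\<^sub>a\<^sub>;\<^sub>b conj m\<^sup>a l\<^sup>b) / 2\<close>.\<close>

definition NP_gamma ::
  "metric \<Rightarrow> vector_field \<Rightarrow> vector_field \<Rightarrow> vector_field \<Rightarrow> point \<Rightarrow> complex"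
  where "NP_gamma g k l m p =
    - (inner_prod g p (cov_deriv g l k p) (l p)
       - inner_prod g p (cov_deriv g l m p) (conj_vec (m p))) / 2"

text \<open>The Weyl scalar \<open>\<Psi>\<^sub>4 = C\<^sub>a\<^sub>b\<^sub>c\<^sub>d conj m\<^sup>a l\<^sup>b conj m\<^sup>c l\<^sup>d\<close>.\<close>

definition NP_Psi4 :: "metric \<Rightarrow> vector_field \<Rightarrow> vector_field \<Rightarrow> point \<Rightarrow> complex"
  where "NP_Psi4 g l m p =
    (\<Sum>a\<in>UNIV. \<Sum>b\<in>UNIV. \<Sum>c\<in>UNIV. \<Sum>d\<in>UNIV. weyl g p a b c d *
       conj_vec (m p) $ a * l p $ b * conj_vec (m p) $ c * l p $ d)"


section \<open>pp-waves\<close>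

text \<open>\<open>ds\<^sup>2 = 2 d\<zeta> d(cnj \<zeta>) - 2 du dv - 2 (f + cnj f) du\<^sup>2\<close>\<close>

definition pp_metric :: "(complex \<Rightarrow> real \<Rightarrow> complex) \<Rightarrow> metric"
  where "pp_metric f = (\<lambda>(\<zeta>, u, v). \<chi> i j.
    if {i, j} = {1, 2} then 1
    else if {i, j} = {3, 4} then -1
    else if i = 3 \<and> j = 3 then -2 * (f \<zeta> u + cnj (f \<zeta> u))
    else 0)"

text \<open>The covariantly constant null vector is \<open>\<partial>\<^sub>v\<close>.\<close>

definition pp_null_vector :: vector_field
  where "pp_null_vector p = axis 4 1"

lemma pp_null_vector_null:
  "inner_prod (pp_metric f) p (pp_null_vector p) (pp_null_vector p) = 0"
  by (cases p) (simp add: inner_prod_def pp_metric_def pp_null_vector_def sum_4 axis_def)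

lemma pp_null_vector_covariantly_constant:
  assumes "(\<lambda>(\<zeta>, u, v::real). f \<zeta> u) differentiable (at p)"
  shows "cov_deriv (pp_metric f) X pp_null_vector p = 0"
proof -
  let ?f = "\<lambda>q::point. f (fst q) (fst (snd q))" and ?g = "pp_metric f"
  let ?h = "\<lambda>q::point. (fst q, fst (snd q), snd (snd p))"
  have "(\<lambda>(\<zeta>, u, v::real). f \<zeta> u) = ?f"
    by (auto simp: fun_eq_iff)
  then obtain f' where f': "(?f has_derivative f') (at p)"
    using assms unfolding differentiable_def by metis
  define F where "F = (\<lambda>q. -2 * (?f q + cnj (?f q)))"
  define F' where "F' = (\<lambda>w. -2 * (f' w + cnj (f' w)))"
  have F': "(F has_derivative F') (at p)"
    unfolding F_def F'_def by (rule has_derivative_mult_right [OF has_derivative_add [OF f' has_derivative_cnj [OF f']]])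
  have h: "(?h has_derivative (\<lambda>w. (fst w, fst (snd w), 0))) (at p)"
    by (auto intro!: derivative_eq_intros)
  have "(F has_derivative F') (at (?h p))"
    using F' by simp
  from diff_chain_at [OF h this]
  have "(F has_derivative F' \<circ> (\<lambda>w. (fst w, fst (snd w), 0))) (at p)"
    by (simp add: F_def o_def)
  then have "F' = F' \<circ> (\<lambda>w. (fst w, fst (snd w), 0))"
    using F' has_derivative_unique by blast
  from fun_cong [OF this, of "(0, 0, 1)"] have "F' (0, 0, 1) = F' 0"
    by (simp add: zero_prod_def)
  also have "F' 0 = 0"
    using F' has_derivative_bounded_linear linear_simps(3) by blast
  finally have "F' (0, 0, 1) = 0" .
  then have F4: "partial 4 F p = 0"
    using frechet_derivative_at [OF F'] by (simp add: partial_def dir_deriv_def)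
  have const: "partial i (\<lambda>q. z) p = 0" for i z
    by (simp add: partial_def dir_deriv_def)
  have d4: "partial i (\<lambda>q. ?g q $ d $ 4) p = 0" "partial i (\<lambda>q. ?g q $ 4 $ d) p = 0" for i d
  proof -
    have "(\<lambda>q. ?g q $ d $ 4) = (\<lambda>q. if d = 3 then -1 else 0)"
         "(\<lambda>q. ?g q $ 4 $ d) = (\<lambda>q. if d = 3 then -1 else 0)"
      by (auto simp: fun_eq_iff pp_metric_def doubleton_eq_iff)
    then show "partial i (\<lambda>q. ?g q $ d $ 4) p = 0" "partial i (\<lambda>q. ?g q $ 4 $ d) p = 0"
      by (simp_all only: const)
  qed
  have "partial 4 (\<lambda>q. ?g q $ i $ j) p = 0" for i j
  proof (cases "i = 3 \<and> j = 3")
    case True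
    then have "(\<lambda>q. ?g q $ i $ j) = F"
      by (auto simp: fun_eq_iff pp_metric_def F_def doubleton_eq_iff)
    then show ?thesis using F4 by simp
  next
    case False
    then have "(\<lambda>q. ?g q $ i $ j) = (\<lambda>q. if {i, j} = {1, 2} then 1 else if {i, j} = {3, 4} then -1 else 0)"
      by (auto simp: fun_eq_iff pp_metric_def)
    then show ?thesis by (simp only: const)
  qed
  then have "christoffel ?g p a b 4 = 0" for a b
    by (simp add: christoffel_def d4)
  moreover have "(\<lambda>q. pp_null_vector q $ a) = (\<lambda>q. axis 4 1 $ a)" for a
    by (simp add: pp_null_vector_def)
  ultimately show ?thesis
    by (simp add: cov_deriv_def vec_eq_iff const sum_4 pp_null_vector_def)
       (simp add: axis_def)
qed

definition aligned :: "point set \<Rightarrow> vector_field \<Rightarrow> bool"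
  where "aligned D k \<longleftrightarrow> (\<forall>p\<in>D. \<exists>s::real. k p = of_real s *s pp_null_vector p)"

definition u_range :: "point set \<Rightarrow> real set"
  where "u_range D = (\<lambda>(\<zeta>, u, v). u) ` D"

definition u_deriv :: "(real \<Rightarrow> 'a::real_normed_vector) \<Rightarrow> real \<Rightarrow> 'a"
  where "u_deriv h u = vector_derivative h (at u)"

text \<open>Form-preserving coordinate changes \<open>(\<zeta>, u, v) \<mapsto> (\<zeta>', u', v')\<close>, and the induced
  relation between the functions \<open>f\<close> on \<open>D\<close> and \<open>f'\<close> on the image of \<open>D\<close>.\<close>

definition pp_coord_change ::
  "real \<Rightarrow> real \<Rightarrow> real \<Rightarrow> (real \<Rightarrow> complex) \<Rightarrow> (real \<Rightarrow> real) \<Rightarrow> point \<Rightarrow> point"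
  where "pp_coord_change \<kappa> u0 c b m = (\<lambda>(\<zeta>, u, v).
    (exp (\<i> * \<kappa>) * (\<zeta> + b u),
     (u + u0) / c,
     c * (v + Re (u_deriv b u * cnj \<zeta> + cnj (u_deriv b u) * \<zeta>) + m u)))"

definition pp_equivalent ::
  "point set \<Rightarrow> (complex \<Rightarrow> real \<Rightarrow> complex) \<Rightarrow> (complex \<Rightarrow> real \<Rightarrow> complex) \<Rightarrow> bool"
  where "pp_equivalent D f f' \<longleftrightarrow>
    (\<exists>\<kappa> u0 c b m. c \<noteq> 0 \<and> smooth_on (u_range D) b \<and> smooth_on (u_range D) m \<and>
      (\<forall>(\<zeta>, u, v) \<in> D. case pp_coord_change \<kappa> u0 c b m (\<zeta>, u, v) of (\<zeta>', u', v') \<Rightarrow>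
        f' \<zeta>' u' = of_real (c\<^sup>2) * (f \<zeta> u - cnj (u_deriv (u_deriv b) u) * \<zeta>
          + (u_deriv b u * cnj (u_deriv b u) - of_real (u_deriv m u)) / 2)))"

end

theory Submission
  imports Defs
begin

text \<open>Alignment and \<open>\<Psi>\<^sub>4 = 1\<close> determine the tetrad as far as needed: \<open>k = s \<partial>\<^sub>v\<close>, the
  \<open>u\<close>-component of \<open>l\<close> is \<open>1 / s\<close>, and \<open>m\<close> has, depending on its orientation, a single
  transversal component \<open>M\<close> with \<open>\<bar>M\<bar> = 1\<close> and \<open>M\<^sup>2 f\<^sub>\<zeta>\<^sub>\<zeta> = s\<^sup>2\<close> or \<open>M\<^sup>2 cnj f\<^sub>\<zeta>\<^sub>\<zeta> = s\<^sup>2\<close>.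
  Differentiating modulus and phase of \<open>f\<^sub>\<zeta>\<^sub>\<zeta> = 2 exp (4 A)\<close> along \<open>l\<close> expresses \<open>\<gamma>\<close> as
  \<open>cnj A\<^sub>u / s\<close> or \<open>A\<^sub>u / s\<close>. Now \<open>Re \<gamma> = 0\<close> says \<open>Re A\<^sub>u = 0\<close>, whence \<open>\<Delta> s = 0\<close>, and then
  \<open>\<Delta> \<gamma> = 0\<close> says \<open>A\<^sub>u\<^sub>u = 0\<close>. Thus \<open>A = A\<^sub>0 + \<i> r u\<close>; a rotation of \<open>\<zeta>\<close> and a scaling of \<open>u\<close>
  remove \<open>A\<^sub>0\<close>.\<close>

section \<open>Wirtinger derivatives and smoothness\<close>

lemma partial_eq:
  assumes "(F has_derivative F') (at p)"
  shows "partial i F p =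
    (if i = 1 then (F' (1, 0, 0) - \<i> * F' (\<i>, 0, 0)) / 2
     else if i = 2 then (F' (1, 0, 0) + \<i> * F' (\<i>, 0, 0)) / 2
     else if i = 3 then F' (0, 1, 0)
     else F' (0, 0, 1))"
  using frechet_derivative_at [OF assms] by (simp add: partial_def dir_deriv_def)

lemma partial_cong:
  assumes "open D" "p \<in> D" "\<And>q. q \<in> D \<Longrightarrow> F q = G q"
  shows "partial i F p = partial i G p"
proof -
  have "(F has_derivative F') (at p) \<longleftrightarrow> (G has_derivative F') (at p)" for F'
    using assms has_derivative_transform_within_open [of F F' p UNIV D G]
      has_derivative_transform_within_open [of G F' p UNIV D F] by auto
  \<comment> \<open>\<open>frechet_derivative\<close> is a choice governed by
    \<open>has_derivative\<close>, so equivalent predicates give equal values even where no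
    derivative exists.\<close>
  then have "frechet_derivative F (at p) = frechet_derivative G (at p)"
    by (simp add: frechet_derivative_def)
  then show ?thesis
    by (simp add: partial_def dir_deriv_def)
qed

lemma partial_const [simp]: "partial i (\<lambda>q. z) p = 0"
  by (simp add: partial_def dir_deriv_def)

text \<open>The condition does not depend on the point, so derivatives can be pushed through the
  case tables that list tensor components.\<close>

lemma partial_if:
  "partial i (\<lambda>q. if P then F q else G q) p = (if P then partial i F p else partial i G p)"
  by simp

lemma partial_add:
  assumes "F differentiable (at p)" "G differentiable (at p)"
  shows "partial i (\<lambda>q. F q + G q) p = partial i F p + partial i G p"
proof -
  obtain F' G' where d: "(F has_derivative F') (at p)" "(G has_derivative G') (at p)"
    using assms by (auto simp: differentiable_def)
  show ?thesis
    by (simp add: partial_eq [OF has_derivative_add [OF d]] partial_eq [OF d(1)] partial_eq [OF d(2)]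
      algebra_simps add_divide_distrib diff_divide_distrib)
qed

lemma partial_mult:
  assumes "F differentiable (at p)" "G differentiable (at p)"
  shows "partial i (\<lambda>q. F q * G q) p = F p * partial i G p + partial i F p * G p"
proof -
  obtain F' G' where d: "(F has_derivative F') (at p)" "(G has_derivative G') (at p)"
    using assms by (auto simp: differentiable_def)
  show ?thesis
    by (simp add: partial_eq [OF has_derivative_mult [OF d]] partial_eq [OF d(1)] partial_eq [OF d(2)]
      algebra_simps add_divide_distrib diff_divide_distrib)
qed

lemma partial_cnj:
  assumes "F differentiable (at p)"
  shows "partial i (\<lambda>q. cnj (F q)) p = cnj (partial (if i = 1 then 2 else if i = 2 then 1 else i) F p)"
proof -
  obtain F' where d: "(F has_derivative F') (at p)"
    using assms by (auto simp: differentiable_def)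
  show ?thesis
    by (simp add: partial_eq [OF has_derivative_cnj [OF d]] partial_eq [OF d])
qed

lemma differentiable_cnj:
  "F differentiable (at p) \<Longrightarrow> (\<lambda>q. cnj (F q)) differentiable (at p)"
  unfolding differentiable_def using has_derivative_cnj by blast

text \<open>The total derivative has no \<open>cnj z\<close> term and no \<open>v\<close> term: this
  encodes holomorphy in \<zeta> and independence of \<open>v\<close>, and names the two remaining
  partial derivatives so that the condition can be iterated.\<close>

definition has_zu_derivs ::
  "point set \<Rightarrow> (complex \<Rightarrow> real \<Rightarrow> complex) \<Rightarrow> (complex \<Rightarrow> real \<Rightarrow> complex) \<Rightarrow>
    (complex \<Rightarrow> real \<Rightarrow> complex) \<Rightarrow> bool"
  where "has_zu_derivs D f fz fu \<longleftrightarrow>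
    (\<forall>(\<zeta>, u, v) \<in> D. ((\<lambda>(\<zeta>, u, v). f \<zeta> u) has_derivative
      (\<lambda>(z, t, _). fz \<zeta> u * z + fu \<zeta> u * of_real t)) (at (\<zeta>, u, v)))"

lemma has_zu_derivs_partial:
  assumes "has_zu_derivs D f fz fu" "p \<in> D"
  shows "(\<lambda>(\<zeta>, u, v). f \<zeta> u) differentiable (at p)"
    and "partial i (\<lambda>(\<zeta>, u, v). f \<zeta> u) p =
      (if i = 1 then (\<lambda>(\<zeta>, u, v). fz \<zeta> u) p else if i = 3 then (\<lambda>(\<zeta>, u, v). fu \<zeta> u) p else 0)"
proof -
  obtain \<zeta> u v where p: "p = (\<zeta>, u, v)" by (cases p)
  have d: "((\<lambda>(\<zeta>, u, v). f \<zeta> u) has_derivative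
      (\<lambda>(z, t, _). fz \<zeta> u * z + fu \<zeta> u * of_real t)) (at p)"
    using assms unfolding has_zu_derivs_def p by auto
  then show "(\<lambda>(\<zeta>, u, v). f \<zeta> u) differentiable (at p)"
    by (auto simp: differentiable_def)
  show "partial i (\<lambda>(\<zeta>, u, v). f \<zeta> u) p =
      (if i = 1 then (\<lambda>(\<zeta>, u, v). fz \<zeta> u) p else if i = 3 then (\<lambda>(\<zeta>, u, v). fu \<zeta> u) p else 0)"
    by (simp add: partial_eq [OF d]) (simp add: p algebra_simps)
qed

text \<open>\<open>exp (4 * A u) * \<zeta>\<^sup>2\<close> and the derivatives of it that are needed
  are all such separated products.\<close>

lemma has_zu_derivs_product:
  assumes "\<And>u. u \<in> u_range D \<Longrightarrow> (h has_vector_derivative h' u) (at u)"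
    and "\<And>\<zeta>. (P has_field_derivative P' \<zeta>) (at \<zeta>)"
  shows "has_zu_derivs D (\<lambda>\<zeta> u. h u * P \<zeta>) (\<lambda>\<zeta> u. h u * P' \<zeta>) (\<lambda>\<zeta> u. h' u * P \<zeta>)"
  unfolding has_zu_derivs_def
proof safe
  fix \<zeta> u v assume "(\<zeta>, u, v) \<in> D"
  then have "u \<in> u_range D"
    by (force simp: u_range_def)
  then have h: "(h has_derivative (\<lambda>t. of_real t * h' u)) (at u)"
    using assms(1) by (simp add: has_vector_derivative_def scaleR_conv_of_real)
  have P: "(P has_derivative (\<lambda>z. P' \<zeta> * z)) (at \<zeta>)"
    using assms(2) by (simp add: has_field_derivative_def)
  have "((\<lambda>q. h (fst (snd q)) * P (fst q)) has_derivative
     (\<lambda>w. h (fst (snd (\<zeta>, u, v))) * (P' \<zeta> * fst w)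
        + of_real (fst (snd w)) * h' u * P (fst (\<zeta>, u, v)))) (at (\<zeta>, u, v))"
    by (intro has_derivative_mult has_derivative_compose [where g = h and f = "\<lambda>q. fst (snd q)"]
        has_derivative_compose [where g = P and f = fst] has_derivative_fst has_derivative_snd has_derivative_ident)
      (use h P in simp_all)
  then show "((\<lambda>(\<zeta>, u, v). h u * P \<zeta>) has_derivative
     (\<lambda>(z, t, _). h u * P' \<zeta> * z + h' u * P \<zeta> * of_real t)) (at (\<zeta>, u, v))"
    by (simp add: case_prod_unfold algebra_simps)
qed

section \<open>The range of u and smooth functions on it\<close>

lemma open_u_range:
  assumes "open D" shows "open (u_range D)"
proof -
  have "u_range D = fst ` (snd ` D)"
    by (simp add: u_range_def image_image case_prod_unfold)
  then show ?thesis
    using assms by (simp add: open_image_fst open_image_snd)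
qed

lemma connected_u_range:
  assumes "connected D" shows "connected (u_range D)"
  unfolding u_range_def case_prod_unfold by (intro connected_continuous_image assms continuous_intros)

lemma smooth_on_imp_differentiable:
  assumes "smooth_on S F" "open S" "x \<in> S"
  shows "F differentiable (at x)" "dir_deriv w F differentiable (at x)"
proof -
  have "fold dir_deriv ws F differentiable_on S" for ws
    using assms(1) by (simp add: smooth_on_def)
  from this [of "[]"] this [of "[w]"] show "F differentiable (at x)" "dir_deriv w F differentiable (at x)"
    using assms(2,3) by (simp_all add: differentiable_on_eq_differentiable_at)
qed

lemma smooth_on_0: "smooth_on (S :: 'a::real_normed_vector set) (\<lambda>_. 0 :: 'b::real_normed_vector)"
proof -
  have 0: "dir_deriv w (\<lambda>_. 0 :: 'b) = (\<lambda>_. 0)" for w :: 'a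
    by (simp add: dir_deriv_def)
  have "fold dir_deriv ws (\<lambda>_. 0 :: 'b) = (\<lambda>_. 0)" for ws :: "'a list"
    by (induction ws) (simp_all add: 0)
  then show ?thesis
    by (simp add: smooth_on_def)
qed

lemma real_differentiable_has_vector_derivative:
  fixes h :: "real \<Rightarrow> 'a::real_normed_vector"
  assumes "h differentiable (at u)"
  shows "(h has_vector_derivative dir_deriv 1 h u) (at u)"
proof -
  have D: "(h has_derivative frechet_derivative h (at u)) (at u)"
    using assms frechet_derivative_works by blast
  have "frechet_derivative h (at u) t = t *\<^sub>R frechet_derivative h (at u) 1" for t
    using linear_scale [OF linear_frechet_derivative [OF assms], of t 1] by simp
  then have "frechet_derivative h (at u) = (\<lambda>t. t *\<^sub>R dir_deriv 1 h u)"
    unfolding dir_deriv_def by (rule ext)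
  then show ?thesis
    using D by (simp add: has_vector_derivative_def)
qed

section \<open>Curvature of a pp-wave\<close>

text \<open>Inverting the \<open>(3, 4)\<close> block moves the wave profile from the entry
  \<open>(3, 3)\<close> to \<open>(4, 4)\<close> and flips its sign.\<close>

definition pp_inverse :: "(complex \<Rightarrow> real \<Rightarrow> complex) \<Rightarrow> metric"
  where "pp_inverse f = (\<lambda>(\<zeta>, u, v). \<chi> i j.
    if {i, j} = {1, 2} then 1
    else if {i, j} = {3, 4} then -1
    else if i = 4 \<and> j = 4 then 2 * (f \<zeta> u + cnj (f \<zeta> u))
    else 0)"

lemma matrix_inv_unique:
  fixes M :: "'a::semiring_1 ^ 'n ^ 'n"
  assumes "M ** N = mat 1" "N ** M = mat 1"
  shows "matrix_inv M = N"
proof -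
  have "M ** matrix_inv M = mat 1 \<and> matrix_inv M ** M = mat 1"
    unfolding matrix_inv_def by (rule someI [of _ N]) (use assms in simp)
  then show ?thesis
    by (metis assms(2) matrix_mul_assoc matrix_mul_lid matrix_mul_rid)
qed

lemma matrix_inv_pp_metric: "matrix_inv (pp_metric f p) = pp_inverse f p"
proof -
  have "pp_metric f p ** pp_inverse f p = mat 1" "pp_inverse f p ** pp_metric f p = mat 1"
    by (cases p; simp add: pp_metric_def pp_inverse_def matrix_matrix_mult_def mat_def vec_eq_iff
      forall_4 sum_4 doubleton_eq_iff)+
  then show ?thesis
    by (rule matrix_inv_unique)
qed

lemma inner_prod_pp_metric:
  "inner_prod (pp_metric f) p X Y = X $ 1 * Y $ 2 + X $ 2 * Y $ 1 - X $ 3 * Y $ 4 - X $ 4 * Y $ 3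
    - 2 * ((\<lambda>(\<zeta>, u, v). f \<zeta> u + cnj (f \<zeta> u)) p) * X $ 3 * Y $ 3"
  by (cases p) (simp add: inner_prod_def pp_metric_def sum_4 doubleton_eq_iff algebra_simps)

text \<open>A general holomorphic profile. Two orders of derivatives are named because the
  Christoffel symbols contain \<open>fz\<close> and \<open>fu\<close>, and curvature differentiates
  them once more.\<close>

locale pp_wave =
  fixes D :: "point set" and f fz fu fzz fzu fuz fuu :: "complex \<Rightarrow> real \<Rightarrow> complex"
  assumes open_D: "open D"
    and f: "has_zu_derivs D f fz fu"
    and fz: "has_zu_derivs D fz fzz fzu"
    and fu: "has_zu_derivs D fu fuz fuu"
begin

abbreviation "g \<equiv> pp_metric f"

abbreviation Fz :: "point \<Rightarrow> complex" where "Fz \<equiv> \<lambda>(\<zeta>, u, v). fz \<zeta> u"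
abbreviation Fu :: "point \<Rightarrow> complex" where "Fu \<equiv> \<lambda>(\<zeta>, u, v). fu \<zeta> u"
abbreviation Fzz :: "point \<Rightarrow> complex" where "Fzz \<equiv> \<lambda>(\<zeta>, u, v). fzz \<zeta> u"

lemma partial_metric:
  assumes "p \<in> D"
  shows "partial i (\<lambda>q. g q $ a $ b) p =
    (if a = 3 \<and> b = 3 then -2 * (if i = 1 then Fz p else if i = 2 then cnj (Fz p)
      else if i = 3 then Fu p + cnj (Fu p) else 0) else 0)"
proof (cases "a = 3 \<and> b = 3")
  case True
  let ?F = "\<lambda>(\<zeta>, u, v). f \<zeta> u"
  note d = has_zu_derivs_partial [OF f assms]
  have "(\<lambda>q. g q $ a $ b) = (\<lambda>q. -2 * (?F q + cnj (?F q)))"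
    using True by (auto simp: fun_eq_iff pp_metric_def doubleton_eq_iff)
  moreover have "partial i (\<lambda>q. -2 * (?F q + cnj (?F q))) p
      = -2 * (partial i ?F p + partial i (\<lambda>q. cnj (?F q)) p)"
    by (subst partial_mult, simp, rule differentiable_add [OF d(1) differentiable_cnj [OF d(1)]])
       (simp add: partial_add [OF d(1) differentiable_cnj [OF d(1)]])
  ultimately show ?thesis
    using True by (simp add: partial_cnj [OF d(1)] d(2))
next
  case False
  then have "(\<lambda>q. g q $ a $ b) = (\<lambda>q. if {a, b} = {1, 2} then 1 else if {a, b} = {3, 4} then -1 else 0)"
    by (auto simp: fun_eq_iff pp_metric_def)
  then show ?thesis
    using False by (simp only: partial_const) simp
qed

text \<open>Only the \<open>(3, 3)\<close> component of the metric varies, and it is independent of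
  \<open>v\<close>. Hence the \<open>(4, 4)\<close> entry of the inverse contributes nothing, and
  the symbols are linear in derivatives of \<open>f\<close>.\<close>

lemma christoffel_eq:
  assumes "p \<in> D"
  shows "christoffel g p a b c =
    (if b = 3 \<and> c = 3 then
       (if a = 1 then cnj (Fz p) else if a = 2 then Fz p else if a = 4 then Fu p + cnj (Fu p) else 0)
     else if a = 4 \<and> {b, c} = {1, 3} then Fz p
     else if a = 4 \<and> {b, c} = {2, 3} then cnj (Fz p)
     else 0)"
  using exhaust_4 [of a] exhaust_4 [of b] exhaust_4 [of c]
  by (elim disjE; simp add: christoffel_def matrix_inv_pp_metric partial_metric [OF assms] sum_4
      pp_inverse_def split_beta doubleton_eq_iff)

lemma partial_christoffel:
  assumes "p \<in> D"
  shows "partial i (\<lambda>q. christoffel g q a b c) p =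
    (if b = 3 \<and> c = 3 then
       (if a = 1 then partial i (\<lambda>q. cnj (Fz q)) p else if a = 2 then partial i Fz p
        else if a = 4 then partial i (\<lambda>q. Fu q + cnj (Fu q)) p else 0)
     else if a = 4 \<and> {b, c} = {1, 3} then partial i Fz p
     else if a = 4 \<and> {b, c} = {2, 3} then partial i (\<lambda>q. cnj (Fz q)) p
     else 0)"
proof -
  have "partial i (\<lambda>q. christoffel g q a b c) p = partial i (\<lambda>q.
    (if b = 3 \<and> c = 3 then
       (if a = 1 then cnj (Fz q) else if a = 2 then Fz q else if a = 4 then Fu q + cnj (Fu q) else 0)
     else if a = 4 \<and> {b, c} = {1, 3} then Fz q
     else if a = 4 \<and> {b, c} = {2, 3} then cnj (Fz q)
     else 0)) p"
    by (rule partial_cong [OF open_D assms]) (rule christoffel_eq)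
  then show ?thesis
    by (simp only: partial_if partial_const)
qed

lemma partial_Fz:
  assumes "p \<in> D"
  shows "partial 1 Fz p = Fzz p" "partial 2 Fz p = 0" "partial 4 Fz p = 0"
    and "partial 1 (\<lambda>q. cnj (Fz q)) p = 0" "partial 2 (\<lambda>q. cnj (Fz q)) p = cnj (Fzz p)"
      "partial 4 (\<lambda>q. cnj (Fz q)) p = 0"
  by (simp_all add: partial_cnj [OF has_zu_derivs_partial(1) [OF fz assms]]
      has_zu_derivs_partial(2) [OF fz assms])

lemma partial_4_Fu:
  assumes "p \<in> D"
  shows "partial 4 (\<lambda>q. Fu q + cnj (Fu q)) p = 0"
proof -
  note d = has_zu_derivs_partial [OF fu assms]
  show ?thesis
    by (simp add: partial_add [OF d(1) differentiable_cnj [OF d(1)]] partial_cnj [OF d(1)] d(2))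
qed

text \<open>The quadratic terms vanish: an upper index other than \<open>4\<close> forces both lower
  indices to be \<open>3\<close>, and no symbol has upper index \<open>3\<close>. Upper index
  \<open>4\<close> enters the lowered tensor only when its first index is \<open>3\<close>, which
  the contraction with \<open>m\<close> later removes.\<close>

lemma riemann_up_eq:
  assumes "p \<in> D" "a \<noteq> 4"
  shows "riemann_up g p a b c d =
    (if b = 3 \<and> (a, c, d) = (1, 2, 3) then cnj (Fzz p)
     else if b = 3 \<and> (a, c, d) = (1, 3, 2) then - cnj (Fzz p)
     else if b = 3 \<and> (a, c, d) = (2, 1, 3) then Fzz p
     else if b = 3 \<and> (a, c, d) = (2, 3, 1) then - Fzz p
     else 0)"
proof (cases "b = 3")
  case True
  then show ?thesis
    using assms(2) exhaust_4 [of a] exhaust_4 [of c] exhaust_4 [of d]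
    by (elim disjE; simp add: riemann_up_def partial_christoffel [OF assms(1)] christoffel_eq [OF assms(1)]
        partial_Fz [OF assms(1)] sum_4)
next
  case False
  then show ?thesis
    using assms(2) exhaust_4 [of a]
    by (elim disjE; simp add: riemann_up_def partial_christoffel [OF assms(1)] christoffel_eq [OF assms(1)]
        sum_4)
qed

text \<open>This is the one trace term with upper index \<open>4\<close>; it vanishes because
  nothing depends on \<open>v\<close> and no Christoffel symbol has a lower index
  \<open>4\<close>.\<close>

lemma riemann_up_44:
  assumes "p \<in> D"
  shows "riemann_up g p 4 b 4 d = 0"
  using exhaust_4 [of b] exhaust_4 [of d]
  by (elim disjE; simp add: riemann_up_def partial_christoffel [OF assms] christoffel_eq [OF assms]
      partial_Fz [OF assms] partial_4_Fu [OF assms] sum_4 doubleton_eq_iff)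

text \<open>The vacuum equation comes from holomorphy: the possible trace terms are mixed
  derivatives in \<zeta> and \<open>cnj \<zeta>\<close>.\<close>

lemma ricci_eq_0: "p \<in> D \<Longrightarrow> ricci g p b d = 0"
  by (simp add: ricci_def sum_4 riemann_up_eq riemann_up_44)

lemma weyl_eq_riemann: "p \<in> D \<Longrightarrow> weyl g p a b c d = riemann g p a b c d"
  by (simp add: weyl_def scalar_curvature_def ricci_eq_0)

lemma riemann_eq:
  assumes "p \<in> D" "a \<noteq> 3"
  shows "riemann g p a b c d =
    (if b = 3 \<and> (a, c, d) = (2, 2, 3) then cnj (Fzz p)
     else if b = 3 \<and> (a, c, d) = (2, 3, 2) then - cnj (Fzz p)
     else if b = 3 \<and> (a, c, d) = (1, 1, 3) then Fzz p
     else if b = 3 \<and> (a, c, d) = (1, 3, 1) then - Fzz p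
     else 0)"
proof -
  have g: "g p $ a $ e = (if (a, e) \<in> {(1, 2), (2, 1)} then 1 else if (a, e) = (4, 3) then -1 else 0)"
    if "a \<noteq> 3" for a e
    using that exhaust_4 [of a] exhaust_4 [of e]
    by (cases p; elim disjE; simp add: pp_metric_def doubleton_eq_iff)
  show ?thesis
    using assms(2) exhaust_4 [of a]
    by (elim disjE; simp add: riemann_def g sum_4 riemann_up_eq [OF assms(1)])
qed

section \<open>Newman-Penrose quantities of the pp-wave\<close>

lemma NP_gamma_eq:
  assumes p: "p \<in> D"
    and k: "\<And>q a. q \<in> D \<Longrightarrow> a \<noteq> 4 \<Longrightarrow> k q $ a = 0" and m: "\<And>q. q \<in> D \<Longrightarrow> m q $ 3 = 0"
  shows "NP_gamma g k l m p =
    (l p $ 3 * NP_Delta l (\<lambda>q. k q $ 4) p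
     + cnj (m p $ 1) * NP_Delta l (\<lambda>q. m q $ 1) p
     + cnj (m p $ 2) * NP_Delta l (\<lambda>q. m q $ 2) p) / 2"
proof -
  have k': "partial i (\<lambda>q. k q $ a) p = 0" if "a \<noteq> 4" for i a
    using partial_cong [OF open_D p, of "\<lambda>q. k q $ a" "\<lambda>q. 0"] k that by simp
  have m': "partial i (\<lambda>q. m q $ 3) p = 0" for i
    using partial_cong [OF open_D p, of "\<lambda>q. m q $ 3" "\<lambda>q. 0"] m by simp
  \<comment> \<open>Christoffel symbols with a lower index \<open>4\<close> vanish, so
    differentiating \<open>k\<close> along \<open>l\<close> only differentiates its
    coefficient.\<close>
  have ck: "cov_deriv g l k p $ a = (if a = 4 then NP_Delta l (\<lambda>q. k q $ 4) p else 0)" for a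
    using exhaust_4 [of a]
    by (elim disjE; simp add: cov_deriv_def NP_Delta_def k' k [OF p] sum_4 christoffel_eq [OF p] doubleton_eq_iff)
  \<comment> \<open>Connection terms with upper index other than \<open>4\<close> would need the
    component \<open>m $ 3\<close>. The component \<open>4\<close> drops out of the product with
    \<open>conj_vec (m p)\<close>, which has no component \<open>3\<close>.\<close>
  have cm: "cov_deriv g l m p $ a = NP_Delta l (\<lambda>q. m q $ a) p" if "a \<noteq> 4" for a
    using exhaust_4 [of a] that
    by (elim disjE; simp add: cov_deriv_def NP_Delta_def m [OF p] m' sum_4 christoffel_eq [OF p] doubleton_eq_iff)
  have "inner_prod g p (cov_deriv g l k p) (l p) = - l p $ 3 * NP_Delta l (\<lambda>q. k q $ 4) p"
    by (simp add: inner_prod_pp_metric ck)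
  moreover have "inner_prod g p (cov_deriv g l m p) (conj_vec (m p)) =
     cnj (m p $ 1) * NP_Delta l (\<lambda>q. m q $ 1) p + cnj (m p $ 2) * NP_Delta l (\<lambda>q. m q $ 2) p"
    using m [OF p] m' by (simp add: inner_prod_pp_metric cm conj_vec_def NP_Delta_def)
  ultimately show ?thesis
    by (simp add: NP_gamma_def)
qed

lemma NP_Psi4_eq:
  assumes "p \<in> D" "m p $ 3 = 0"
  shows "NP_Psi4 g l m p =
    (l p $ 3)\<^sup>2 * ((cnj (m p $ 2))\<^sup>2 * Fzz p + (cnj (m p $ 1))\<^sup>2 * cnj (Fzz p))"
proof -
  have m3: "conj_vec (m p) $ 3 = 0"
    using assms(2) by (simp add: conj_vec_def)
  \<comment> \<open>Terms with \<open>a = 3\<close> are killed by \<open>m3\<close>; for the others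
    the curvature table requires \<open>b = 3\<close>. Discarding the rest first keeps the expansion
    of the fourfold sum small.\<close>
  have "NP_Psi4 g l m p = (\<Sum>a\<in>UNIV. \<Sum>b\<in>UNIV. \<Sum>c\<in>UNIV. \<Sum>d\<in>UNIV.
       if a = 3 \<or> b \<noteq> 3 then 0 else riemann g p a b c d *
       conj_vec (m p) $ a * l p $ b * conj_vec (m p) $ c * l p $ d)"
    unfolding NP_Psi4_def
  proof (intro sum.cong refl)
    fix a b c d :: 4
    show "weyl g p a b c d * conj_vec (m p) $ a * l p $ b * conj_vec (m p) $ c * l p $ d =
      (if a = 3 \<or> b \<noteq> 3 then 0 else riemann g p a b c d *
       conj_vec (m p) $ a * l p $ b * conj_vec (m p) $ c * l p $ d)"
      using assms(1) m3 by (cases "a = 3") (simp_all add: weyl_eq_riemann riemann_eq)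
  qed
  also have "\<dots> = (l p $ 3)\<^sup>2 * ((cnj (m p $ 2))\<^sup>2 * Fzz p + (cnj (m p $ 1))\<^sup>2 * cnj (Fzz p))"
    using assms by (simp add: sum_4 riemann_eq conj_vec_def power2_eq_square algebra_simps)
  finally show ?thesis .
qed

end

section \<open>The spin coefficient gamma in an aligned tetrad\<close>

lemma NP_Delta_cong:
  assumes "open D" "p \<in> D" "\<And>q. q \<in> D \<Longrightarrow> F q = G q"
  shows "NP_Delta l F p = NP_Delta l G p"
  unfolding NP_Delta_def by (intro sum.cong refl arg_cong2 [where f = "(*)"] partial_cong [OF assms])

lemma NP_Delta_const [simp]: "NP_Delta l (\<lambda>q. z) p = 0"
  by (simp add: NP_Delta_def)

lemma NP_Delta_mult:
  assumes "F differentiable (at p)" "G differentiable (at p)"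
  shows "NP_Delta l (\<lambda>q. F q * G q) p = F p * NP_Delta l G p + NP_Delta l F p * G p"
  by (simp add: NP_Delta_def partial_mult [OF assms] sum_4 algebra_simps)

lemma NP_Delta_cnj:
  assumes "F differentiable (at p)" "conj_vec (l p) = l p"
  shows "NP_Delta l (\<lambda>q. cnj (F q)) p = cnj (NP_Delta l F p)"
proof -
  have "conj_vec (l p) $ i = l p $ i" for i
    using assms(2) by simp
  from this [of 1] this [of 2] this [of 3] this [of 4]
  have "cnj (l p $ 1) = l p $ 2" "cnj (l p $ 2) = l p $ 1" "cnj (l p $ 3) = l p $ 3" "cnj (l p $ 4) = l p $ 4"
    by (simp_all add: conj_vec_def)
  then show ?thesis
    by (simp add: NP_Delta_def partial_cnj [OF assms(1)] sum_4)
qed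

lemma NP_Delta_u_function:
  assumes "(h has_vector_derivative h') (at (fst (snd p)))"
  shows "(\<lambda>q. h (fst (snd q))) differentiable (at p)"
    and "NP_Delta l (\<lambda>q. h (fst (snd q))) p = l p $ 3 * h'"
proof -
  \<comment> \<open>A function of \<open>u\<close> is a separated product with constant factor
    \<open>1\<close>; the condition is pointwise, so the singleton domain suffices.\<close>
  have "has_zu_derivs {p} (\<lambda>\<zeta> u. h u * 1) (\<lambda>\<zeta> u. h u * 0) (\<lambda>\<zeta> u. h' * 1)"
    using assms by (intro has_zu_derivs_product) (auto simp: u_range_def case_prod_unfold)
  from has_zu_derivs_partial [OF this, of p]
  show "(\<lambda>q. h (fst (snd q))) differentiable (at p)"
    and "NP_Delta l (\<lambda>q. h (fst (snd q))) p = l p $ 3 * h'"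
    by (simp_all add: case_prod_unfold NP_Delta_def sum_4)
qed

section \<open>Components of an aligned null tetrad\<close>

lemma null_tetrad_differentiable:
  assumes "null_tetrad g D k l m" "open D" "p \<in> D"
  shows "(\<lambda>q. k q $ i) differentiable (at p)" "(\<lambda>q. l q $ i) differentiable (at p)"
    "(\<lambda>q. m q $ i) differentiable (at p)"
  using assms by (auto simp: null_tetrad_def smooth_vector_field_def intro: smooth_on_imp_differentiable)

text \<open>Each component relation is one tetrad product: \<open>k\<close> with \<open>l\<close>
  fixes the component \<open>l $ 3\<close>, \<open>k\<close> with \<open>m\<close> kills
  \<open>m $ 3\<close>, and nullity of \<open>m\<close> leaves at most one of \<open>m $ 1\<close>,
  \<open>m $ 2\<close>, whose modulus is then \<open>1\<close>.\<close>

lemma null_tetrad_components: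
  assumes "null_tetrad (pp_metric f) D k l m" "aligned D k" "p \<in> D"
  shows "a \<noteq> 4 \<Longrightarrow> k p $ a = 0" "m p $ 3 = 0" "k p $ 4 * l p $ 3 = 1"
    and "cnj (k p $ 4) = k p $ 4" "cnj (l p $ 3) = l p $ 3" "conj_vec (l p) = l p"
    and "m p $ 1 * m p $ 2 = 0" "m p $ 1 * cnj (m p $ 1) + m p $ 2 * cnj (m p $ 2) = 1"
proof -
  obtain s :: real where s: "k p = of_real s *s axis 4 1"
    using assms(2,3) by (auto simp: aligned_def pp_null_vector_def)
  have k: "k p $ a = (if a = 4 then of_real s else 0)" for a
    by (simp add: s axis_def)
  have t: "conj_vec (l p) = l p" "inner_prod (pp_metric f) p (k p) (l p) = -1"
    "inner_prod (pp_metric f) p (m p) (m p) = 0" "inner_prod (pp_metric f) p (m p) (conj_vec (m p)) = 1"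
    "inner_prod (pp_metric f) p (k p) (m p) = 0"
    using assms(1,3) unfolding null_tetrad_def by blast+
  show "a \<noteq> 4 \<Longrightarrow> k p $ a = 0" "cnj (k p $ 4) = k p $ 4" "conj_vec (l p) = l p"
    by (simp_all add: k t)
  show kl: "k p $ 4 * l p $ 3 = 1"
    using t(2) by (simp add: inner_prod_pp_metric k)
  show m3: "m p $ 3 = 0"
    using t(5) kl by (auto simp: inner_prod_pp_metric k)
  show "cnj (l p $ 3) = l p $ 3"
    using arg_cong [OF t(1), of "\<lambda>x. x $ 3"] by (simp add: conj_vec_def)
  show "m p $ 1 * m p $ 2 = 0"
    using t(3) m3 by (simp add: inner_prod_pp_metric)
  show "m p $ 1 * cnj (m p $ 1) + m p $ 2 * cnj (m p $ 2) = 1"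
    using t(4) m3 by (simp add: inner_prod_pp_metric conj_vec_def)
qed

text \<open>Since \<open>\<Delta>\<close> is a real derivation, \<open>\<Delta> s / s\<close> is real and \<open>\<Delta> M / M\<close> is imaginary, so that they
  are the two parts of the logarithmic derivative of \<open>G = s\<^sup>2 / M\<^sup>2\<close>.\<close>

lemma NP_Delta_modulus_phase:
  assumes "open D" "p \<in> D" "conj_vec (l p) = l p"
    and diff: "M differentiable (at p)" "s differentiable (at p)" "G differentiable (at p)"
    and M: "\<And>q. q \<in> D \<Longrightarrow> M q * cnj (M q) = 1"
    and s: "\<And>q. q \<in> D \<Longrightarrow> cnj (s q) = s q" "s p \<noteq> 0"
    and MGs: "\<And>q. q \<in> D \<Longrightarrow> M q * M q * G q = s q * s q"
    and G: "NP_Delta l G p = 4 * \<beta> * G p"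
  shows "NP_Delta l s p = 2 * of_real (Re \<beta>) * s p"
    and "cnj (M p) * NP_Delta l M p = - 2 * \<i> * of_real (Im \<beta>)"
proof -
  let ?\<Delta> = "\<lambda>F. NP_Delta l F p"
  note cong = NP_Delta_cong [OF assms(1,2)]
  have dMM: "(\<lambda>q. M q * M q) differentiable (at p)"
    by (intro differentiable_mult diff)
  \<comment> \<open>Logarithmic derivatives of \<open>s\<close> and \<open>M\<close>;
    \<open>cnj (M p)\<close> serves as the inverse of \<open>M p\<close>.\<close>
  define x y where "x = ?\<Delta> s / s p" and "y = cnj (M p) * ?\<Delta> M"
  have "cnj (?\<Delta> s) = ?\<Delta> s"
    by (rule trans [OF NP_Delta_cnj [where l = l and p = p, OF diff(2) assms(3), symmetric] cong [OF s(1)]])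
  then have "cnj x = x"
    using s(1) [OF assms(2)] by (simp add: x_def)
  then have x: "Im x = 0"
    by (simp add: complex_eq_iff)
  have "?\<Delta> (\<lambda>q. M q * cnj (M q)) = 0"
    by (rule trans [OF cong [OF M] NP_Delta_const])
  then have "y + cnj y = 0"
    unfolding NP_Delta_mult [OF diff(1) differentiable_cnj [OF diff(1)]]
      NP_Delta_cnj [where l = l and p = p, OF diff(1) assms(3)] y_def by (simp add: ac_simps)
  then have y: "Re y = 0"
    by (simp add: complex_eq_iff)
  have "?\<Delta> (\<lambda>q. M q * M q * G q) = ?\<Delta> (\<lambda>q. s q * s q)"
    by (rule cong [OF MGs])
  then have "M p * M p * ?\<Delta> G + 2 * M p * ?\<Delta> M * G p = 2 * s p * ?\<Delta> s"
    unfolding NP_Delta_mult [OF dMM diff(3)] NP_Delta_mult [OF diff(1,1)] NP_Delta_mult [OF diff(2,2)]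
    by (simp add: algebra_simps)
  moreover have "?\<Delta> s = x * s p"
    using s(2) by (simp add: x_def)
  moreover have "?\<Delta> M = y * M p"
  proof -
    have "y * M p = (M p * cnj (M p)) * ?\<Delta> M"
      by (simp add: y_def)
    then show ?thesis
      using M [OF assms(2)] by simp
  qed
  ultimately have "M p * M p * (4 * \<beta> * G p) + 2 * M p * (y * M p) * G p = 2 * s p * (x * s p)"
    by (simp only: G)
  then have "M p * M p * G p * (4 * \<beta> + 2 * y) = s p * s p * (2 * x)"
    by (simp add: algebra_simps)
  \<comment> \<open>Cancel \<open>M\<^sup>2 G = s\<^sup>2\<close>, which is nonzero. As
    \<open>x\<close> is real and \<open>y\<close> imaginary, real and imaginary parts determine
    both.\<close>
  then have "4 * \<beta> + 2 * y = 2 * x"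
    using MGs [OF assms(2)] s(2) by simp
  then have "4 * Re \<beta> + 2 * Re y = 2 * Re x" "4 * Im \<beta> + 2 * Im y = 2 * Im x"
    by (simp_all add: complex_eq_iff)
  then have "x = 2 * of_real (Re \<beta>)" "y = - 2 * \<i> * of_real (Im \<beta>)"
    using x y by (simp_all add: complex_eq_iff)
  then show "?\<Delta> s = 2 * of_real (Re \<beta>) * s p" "cnj (M p) * ?\<Delta> M = - 2 * \<i> * of_real (Im \<beta>)"
    using \<open>?\<Delta> s = x * s p\<close> by (simp_all add: y_def)
qed

context pp_wave begin

text \<open>Both orientations at once: \<open>i\<close> is the surviving component of
  \<open>m\<close> and \<open>j\<close> the vanishing one, while \<open>G\<close> is
  \<open>Fzz\<close> or its conjugate. Modulus and phase contribute \<open>Re \<beta>\<close> and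
  \<open>- \<i> * Im \<beta>\<close>, hence the conjugate.\<close>

lemma NP_gamma_of_polarization:
  assumes tetrad: "null_tetrad g D k l m" and "aligned D k"
    and E: "open E" "E \<subseteq> D" "p \<in> E"
    and ij: "(i, j) = (1, 2) \<or> (i, j) = (2, 1)"
    and mj: "\<And>q. q \<in> E \<Longrightarrow> m q $ j = 0"
    and G: "G differentiable (at p)" "NP_Delta l G p = 4 * \<beta> * G p"
    and mG: "\<And>q. q \<in> E \<Longrightarrow> m q $ i * m q $ i * G q = k q $ 4 * k q $ 4"
  shows "NP_Delta l (\<lambda>q. k q $ 4) p = 2 * of_real (Re \<beta>) * k p $ 4"
    and "NP_gamma g k l m p = cnj \<beta>"
proof -
  have p: "p \<in> D" using E by auto
  note comp = null_tetrad_components [OF tetrad \<open>aligned D k\<close>]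
  note diff = null_tetrad_differentiable [OF tetrad open_D p]
  have norm: "m q $ i * cnj (m q $ i) = 1" if "q \<in> E" for q
    using comp(8) [of q] mj [OF that] ij that E(2) by auto
  have real: "cnj (k q $ 4) = k q $ 4" if "q \<in> E" for q
    by (rule comp(4) [OF subsetD [OF E(2) that]])
  have "k p $ 4 \<noteq> 0"
    using comp(3) [OF p] by auto
  note * = NP_Delta_modulus_phase [where M = "\<lambda>q. m q $ i" and s = "\<lambda>q. k q $ 4",
      OF E(1,3) comp(6) [OF p] diff(3) diff(1) G(1) norm real this mG G(2)]
  show k: "NP_Delta l (\<lambda>q. k q $ 4) p = 2 * of_real (Re \<beta>) * k p $ 4"
    by (rule *(1))
  have mi: "cnj (m p $ i) * NP_Delta l (\<lambda>q. m q $ i) p = - 2 * \<i> * of_real (Im \<beta>)"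
    by (rule *(2))
  have "NP_gamma g k l m p = (l p $ 3 * NP_Delta l (\<lambda>q. k q $ 4) p
     + cnj (m p $ 1) * NP_Delta l (\<lambda>q. m q $ 1) p
     + cnj (m p $ 2) * NP_Delta l (\<lambda>q. m q $ 2) p) / 2"
    by (rule NP_gamma_eq [OF p comp(1) comp(2)])
  also have "\<dots> = (l p $ 3 * NP_Delta l (\<lambda>q. k q $ 4) p
     + cnj (m p $ i) * NP_Delta l (\<lambda>q. m q $ i) p) / 2"
    using ij mj [OF E(3)] by auto
  also have "l p $ 3 * NP_Delta l (\<lambda>q. k q $ 4) p = 2 * of_real (Re \<beta>) * (k p $ 4 * l p $ 3)"
    by (simp add: k)
  also have "\<dots> = 2 * of_real (Re \<beta>)"
    by (simp add: comp(3) [OF p])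
  also have "(2 * of_real (Re \<beta>) + cnj (m p $ i) * NP_Delta l (\<lambda>q. m q $ i) p) / 2 = cnj \<beta>"
    by (simp add: mi complex_eq_iff)
  finally show "NP_gamma g k l m p = cnj \<beta>" .
qed

text \<open>The two alternatives correspond to the two orientations of \<open>m\<close>.\<close>

lemma NP_gamma_eq_log_derivative:
  assumes tetrad: "null_tetrad g D k l m" and "aligned D k"
    and Psi4: "\<And>q. q \<in> D \<Longrightarrow> NP_Psi4 g l m q = 1"
    and \<beta>: "\<And>q. q \<in> D \<Longrightarrow> NP_Delta l Fzz q = 4 * \<beta> q * Fzz q"
    and diff_Fzz: "\<And>q. q \<in> D \<Longrightarrow> Fzz differentiable (at q)"
    and p: "p \<in> D"
  obtains E where "open E" "p \<in> E" "E \<subseteq> D"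
    "\<And>q. q \<in> E \<Longrightarrow> NP_Delta l (\<lambda>q. k q $ 4) q = 2 * of_real (Re (\<beta> q)) * k q $ 4"
    "(\<forall>q\<in>E. NP_gamma g k l m q = \<beta> q) \<or> (\<forall>q\<in>E. NP_gamma g k l m q = cnj (\<beta> q))"
proof -
  note comp = null_tetrad_components [OF tetrad \<open>aligned D k\<close>]
  \<comment> \<open>The orientation is locally constant: \<open>E 1\<close> and \<open>E 2\<close>
    are open and cover \<open>D\<close>. Openness is needed because \<gamma> is differentiated
    later.\<close>
  define E where "E i = {q \<in> D. m q $ i \<noteq> 0}" for i :: 4
  have E: "open (E i)" "E i \<subseteq> D" for i
  proof -
    have "continuous_on D (\<lambda>q. m q $ i)"
      using null_tetrad_differentiable(3) [OF tetrad open_D]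
      by (intro continuous_at_imp_continuous_on) (auto intro: differentiable_imp_continuous_within)
    then have "open (D \<inter> (\<lambda>q. m q $ i) -` (- {0}))"
      by (intro continuous_open_preimage open_D) auto
    also have "D \<inter> (\<lambda>q. m q $ i) -` (- {0}) = E i"
      by (auto simp: E_def)
    finally show "open (E i)" .
  qed (auto simp: E_def)
  have Psi: "(l q $ 3)\<^sup>2 * ((cnj (m q $ 2))\<^sup>2 * Fzz q + (cnj (m q $ 1))\<^sup>2 * cnj (Fzz q)) = 1"
    if "q \<in> D" for q
    using NP_Psi4_eq [where l = l, OF that, of m, OF comp(2) [OF that]] Psi4 [OF that] by simp
  \<comment> \<open>Multiplying by the square of \<open>k q $ 4\<close>, the inverse of
    \<open>l q $ 3\<close>, solves the normalization of \<open>NP_Psi4\<close> for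
    \<open>X\<close>.\<close>
  have clear: "X = k q $ 4 * k q $ 4" if "q \<in> D" "(l q $ 3)\<^sup>2 * X = 1" for q X
  proof -
    have "(k q $ 4 * l q $ 3)\<^sup>2 * X = (k q $ 4)\<^sup>2 * ((l q $ 3)\<^sup>2 * X)"
      by (simp add: power2_eq_square)
    then show ?thesis
      unfolding comp(3) [OF that(1)] that(2) by (simp add: power2_eq_square)
  qed
  have "m p $ 1 \<noteq> 0 \<or> m p $ 2 \<noteq> 0"
    using comp(8) [OF p] by (cases "m p $ 1 = 0") auto
  then consider "p \<in> E 1" | "p \<in> E 2"
    using p by (auto simp: E_def)
  then show thesis
  proof cases
    case 1
    have m2: "m q $ 2 = 0" if "q \<in> E 1" for q
      using comp(7) [of q] that by (auto simp: E_def)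
    have "m q $ 1 * m q $ 1 * Fzz q = k q $ 4 * k q $ 4" if "q \<in> E 1" for q
    proof (rule clear)
      show "q \<in> D" using that by (simp add: E_def)
      \<comment> \<open>\<open>NP_Psi4\<close> contains the conjugate of \<open>m\<close>; since
        \<open>l q $ 3\<close> and the value \<open>1\<close> are real, conjugation gives the
        relation for \<open>m\<close> itself.\<close>
      then have "cnj ((l q $ 3)\<^sup>2 * ((cnj (m q $ 1))\<^sup>2 * cnj (Fzz q))) = 1"
        using Psi [of q] m2 [OF that] by simp
      then show "(l q $ 3)\<^sup>2 * (m q $ 1 * m q $ 1 * Fzz q) = 1"
        using comp(5) [OF \<open>q \<in> D\<close>] by (simp add: power2_eq_square)
    qed
    note * = NP_gamma_of_polarization [OF tetrad \<open>aligned D k\<close> E(1,2), where i = 1 and j = 2 and G = Fzz,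
        OF _ _ m2 diff_Fzz \<beta> this]
    show thesis
      by (rule that [OF E(1) 1 E(2)]) (use * E(2) in blast)+
  next
    case 2
    have m1: "m q $ 1 = 0" if "q \<in> E 2" for q
      using comp(7) [of q] that by (auto simp: E_def)
    have mk: "m q $ 2 * m q $ 2 * cnj (Fzz q) = k q $ 4 * k q $ 4" if "q \<in> E 2" for q
    proof (rule clear)
      show "q \<in> D" using that by (simp add: E_def)
      then have "cnj ((l q $ 3)\<^sup>2 * ((cnj (m q $ 2))\<^sup>2 * Fzz q)) = 1"
        using Psi [of q] m1 [OF that] by simp
      then show "(l q $ 3)\<^sup>2 * (m q $ 2 * m q $ 2 * cnj (Fzz q)) = 1"
        using comp(5) [OF \<open>q \<in> D\<close>] by (simp add: power2_eq_square)
    qed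
    \<comment> \<open>For this orientation \<open>G\<close> is the conjugate of \<open>Fzz\<close>,
      so \<beta> is replaced by its conjugate and \<gamma> becomes \<beta>; the real part governing
      \<open>k\<close> is unchanged.\<close>
    have c\<beta>: "NP_Delta l (\<lambda>q. cnj (Fzz q)) q = 4 * cnj (\<beta> q) * cnj (Fzz q)" if "q \<in> D" for q
      using NP_Delta_cnj [where F = Fzz and l = l and p = q, OF diff_Fzz [OF that] comp(6) [OF that]] \<beta> [OF that]
      by simp
    note * = NP_gamma_of_polarization [OF tetrad \<open>aligned D k\<close> E(1,2),
        where i = 2 and j = 1 and G = "\<lambda>q. cnj (Fzz q)",
        OF _ _ m1 differentiable_cnj [OF diff_Fzz] c\<beta> mk]
    have "NP_Delta l (\<lambda>q. k q $ 4) q = 2 * of_real (Re (\<beta> q)) * k q $ 4" "NP_gamma g k l m q = \<beta> q"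
      if "q \<in> E 2" for q
      using *[of q] that E(2) by auto
    then show thesis
      by (intro that [OF E(1) 2 E(2)]) auto
  qed
qed

end

section \<open>Affine exponents\<close>

lemma linear_exponent_pp_equivalent:
  assumes "\<And>u. u \<in> u_range D \<Longrightarrow> A u = A0 + \<i> * of_real (r * u)"
  shows "\<exists>k0::real. pp_equivalent D (\<lambda>\<zeta> u. exp (4 * A u) * \<zeta>\<^sup>2)
    (\<lambda>\<zeta> u. exp (2 * \<i> * of_real k0 * of_real u) * \<zeta>\<^sup>2)"
proof -
  define c where "c = exp (- 2 * Re A0)"
  define \<kappa> where "\<kappa> = 2 * Im A0"
  have "c \<noteq> 0"
    by (simp add: c_def)
  have eq: "exp (2 * \<i> * of_real (2 * r * c) * of_real (u / c)) * (exp (\<i> * of_real \<kappa>) * \<zeta>)\<^sup>2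
      = of_real (c\<^sup>2) * (exp (4 * A u) * \<zeta>\<^sup>2)" if "u \<in> u_range D" for \<zeta> u
  proof -
    have "2 * \<i> * of_real (2 * r * c) * of_real (u / c) + (\<i> * of_real \<kappa> + \<i> * of_real \<kappa>)
        = of_real (- 2 * Re A0) + of_real (- 2 * Re A0) + 4 * A u"
      using \<open>c \<noteq> 0\<close> by (simp add: assms [OF that] \<kappa>_def complex_eq_iff)
    then have "exp (2 * \<i> * of_real (2 * r * c) * of_real (u / c)) * (exp (\<i> * of_real \<kappa>) * exp (\<i> * of_real \<kappa>))
        = of_real c * of_real c * exp (4 * A u)"
      unfolding c_def exp_of_real [symmetric] by (simp only: exp_add [symmetric])
    from arg_cong [OF this, of "\<lambda>x. x * \<zeta>\<^sup>2"] show ?thesis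
      by (simp only: power2_eq_square mult_ac of_real_mult)
  qed
  have u0: "u_deriv (\<lambda>_. 0 :: complex) = (\<lambda>_. 0)" "u_deriv (\<lambda>_. 0 :: real) = (\<lambda>_. 0)"
    by (simp_all add: u_deriv_def fun_eq_iff)
  have "pp_equivalent D (\<lambda>\<zeta> u. exp (4 * A u) * \<zeta>\<^sup>2)
    (\<lambda>\<zeta> u. exp (2 * \<i> * of_real (2 * r * c) * of_real u) * \<zeta>\<^sup>2)"
    unfolding pp_equivalent_def
  proof (rule exI [of _ \<kappa>], rule exI [of _ 0], rule exI [of _ c], rule exI [of _ "\<lambda>_. 0"],
      rule exI [of _ "\<lambda>_. 0"], intro conjI ballI smooth_on_0 \<open>c \<noteq> 0\<close>)
    fix p assume "p \<in> D"
    moreover obtain \<zeta> u v where p: "p = (\<zeta>, u, v)"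
      by (cases p)
    ultimately have "u \<in> u_range D"
      by (force simp: u_range_def)
    from eq [OF this, of \<zeta>] show "case p of (\<zeta>, u, v) \<Rightarrow>
        case pp_coord_change \<kappa> 0 c (\<lambda>_. 0) (\<lambda>_. 0) (\<zeta>, u, v) of (\<zeta>', u', v') \<Rightarrow>
          exp (2 * \<i> * of_real (2 * r * c) * of_real u') * \<zeta>'\<^sup>2 = of_real (c\<^sup>2) *
            (exp (4 * A u) * \<zeta>\<^sup>2 - cnj (u_deriv (u_deriv (\<lambda>_. 0)) u) * \<zeta> +
             (u_deriv (\<lambda>_. 0) u * cnj (u_deriv (\<lambda>_. 0) u) - of_real (u_deriv (\<lambda>_. 0) u)) / 2)"
      by (simp only: p pp_coord_change_def prod.case u0 complex_cnj_zero mult_zero_left add_0_right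
          diff_zero of_real_0 div_0)
  qed
  then show ?thesis ..
qed

text \<open>A connected set of reals is convex, so a vanishing derivative means constancy; this is
  applied to \<open>A'\<close> and then to \<open>A\<close> minus its linear part.\<close>

lemma affine_if_derivative_constant:
  fixes A :: "real \<Rightarrow> complex"
  assumes "connected U"
    and A: "\<And>u. u \<in> U \<Longrightarrow> (A has_vector_derivative A' u) (at u)"
    and A': "\<And>u. u \<in> U \<Longrightarrow> (A' has_vector_derivative 0) (at u)" "\<And>u. u \<in> U \<Longrightarrow> Re (A' u) = 0"
  obtains A0 r where "\<And>u. u \<in> U \<Longrightarrow> A u = A0 + \<i> * of_real (r * u)"
proof -
  have "convex U"
    using assms(1) by (simp add: connected_convex_1)
  from has_vector_derivative_zero_constant [OF this has_vector_derivative_at_within [OF A'(1)]]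
  obtain c where c: "\<And>u. u \<in> U \<Longrightarrow> A' u = c"
    by blast
  have "((\<lambda>u. A u - of_real u * c) has_vector_derivative 0) (at u within U)" if "u \<in> U" for u
  proof -
    have "((\<lambda>u. A u - of_real u * c) has_vector_derivative (A' u - of_real 1 * c)) (at u)"
      by (intro has_vector_derivative_diff A that has_vector_derivative_mult_left has_vector_derivative_of_real)
         (rule derivative_eq_intros refl)+
    then show ?thesis
      using c [OF that] by (simp add: has_vector_derivative_at_within)
  qed
  from has_vector_derivative_zero_constant [OF \<open>convex U\<close> this]
  obtain A0 where A0: "\<And>u. u \<in> U \<Longrightarrow> A u - of_real u * c = A0"
    by blast
  show thesis
  proof (rule that)
    fix u assume u: "u \<in> U"
    \<comment> \<open>Read off at the given point \<open>u\<close>, so an empty \<open>U\<close>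
      needs no separate treatment.\<close>
    have "c = \<i> * of_real (Im c)"
      using A'(2) [OF u] c [OF u] by (simp add: complex_eq_iff)
    then have "of_real u * c = \<i> * of_real (Im c * u)"
      by (subst \<open>c = _\<close>) (simp add: mult_ac)
    then show "A u = A0 + \<i> * of_real (Im c * u)"
      using A0 [OF u] by (simp add: algebra_simps)
  qed
qed

section \<open>From constant imaginary gamma to the normal form\<close>

theorem proposition9p3:
  fixes D :: "point set" and A :: "real \<Rightarrow> complex" and f :: "complex \<Rightarrow> real \<Rightarrow> complex"
    and k l m :: vector_field
  assumes "open D" and "connected D" and "D \<noteq> {}"
    and "smooth_on (u_range D) A"
    and "f = (\<lambda>\<zeta> u. exp (4 * A u) * \<zeta>\<^sup>2)"
    and "null_tetrad (pp_metric f) D k l m" and "aligned D k"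
    and "\<forall>p\<in>D. NP_Psi4 (pp_metric f) l m p = 1"
    and "\<forall>p\<in>D. NP_Delta l (NP_gamma (pp_metric f) k l m) p = 0"
    and "\<forall>p\<in>D. Re (NP_gamma (pp_metric f) k l m p) = 0"
  shows "\<exists>k0::real. pp_equivalent D f (\<lambda>\<zeta> u. exp (2 * \<i> * of_real k0 * of_real u) * \<zeta>\<^sup>2)"
proof -
  let ?U = "u_range D"
  define A' where "A' = dir_deriv 1 A"
  define A'' where "A'' = dir_deriv 1 A'"
  define a where "a u = exp (4 * A u)" for u
  define a' where "a' u = 4 * A' u * a u" for u
  define a'' where "a'' u = 4 * A' u * a' u + 4 * A'' u * a u" for u
  note smooth = smooth_on_imp_differentiable [OF assms(4) open_u_range [OF assms(1)]]
  have A: "(A has_vector_derivative A' u) (at u)" if "u \<in> ?U" for u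
    unfolding A'_def by (rule real_differentiable_has_vector_derivative [OF smooth(1) [OF that]])
  have A': "(A' has_vector_derivative A'' u) (at u)" if "u \<in> ?U" for u
    unfolding A''_def A'_def by (rule real_differentiable_has_vector_derivative [OF smooth(2) [OF that]])
  have a: "(a has_vector_derivative a' u) (at u)" if "u \<in> ?U" for u
  proof -
    have "((exp \<circ> (\<lambda>u. 4 * A u)) has_vector_derivative (4 * A' u) * exp (4 * A u)) (at u)"
      by (intro field_vector_diff_chain_at has_vector_derivative_mult_right A that DERIV_exp)
    then show ?thesis
      by (simp add: o_def a_def [abs_def] a'_def)
  qed
  have a': "(a' has_vector_derivative a'' u) (at u)" if "u \<in> ?U" for u
    unfolding a'_def [abs_def] a''_def
    by (intro has_vector_derivative_mult has_vector_derivative_mult_right A' a [unfolded a'_def] that)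
  have sq: "((\<lambda>\<zeta>::complex. \<zeta>\<^sup>2) has_field_derivative 2 * \<zeta>) (at \<zeta>)"
    and lin: "((\<lambda>\<zeta>::complex. 2 * \<zeta>) has_field_derivative 2) (at \<zeta>)" for \<zeta>
    by (auto intro!: derivative_eq_intros)
  interpret pp_wave D f "\<lambda>\<zeta> u. a u * (2 * \<zeta>)" "\<lambda>\<zeta> u. a' u * \<zeta>\<^sup>2" "\<lambda>\<zeta> u. a u * 2"
    "\<lambda>\<zeta> u. a' u * (2 * \<zeta>)" "\<lambda>\<zeta> u. a' u * (2 * \<zeta>)" "\<lambda>\<zeta> u. a'' u * \<zeta>\<^sup>2"
    unfolding pp_wave_def assms(5) a_def [symmetric]
    by (intro conjI assms(1) has_zu_derivs_product a a' sq lin)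
  note comp = null_tetrad_components [OF assms(6,7)] and diff = null_tetrad_differentiable [OF assms(6,1)]
  \<comment> \<open>\<open>Fzz = 2 * a\<close> has logarithmic \<open>u\<close>-derivative
    \<open>4 * A'\<close>, and \<Delta> acts on functions of \<open>u\<close> as
    \<open>l $ 3\<close> times the derivative.\<close>
  define \<beta> where "\<beta> q = l q $ 3 * A' (fst (snd q))" for q
  have U: "fst (snd q) \<in> ?U" if "q \<in> D" for q
    using that by (force simp: u_range_def case_prod_unfold)
  have Fzz_diff: "(\<lambda>q::point. a (fst (snd q)) * 2) differentiable (at q)"
    and Fzz_Delta: "NP_Delta l (\<lambda>q. a (fst (snd q)) * 2) q = 4 * \<beta> q * (a (fst (snd q)) * 2)"
    if "q \<in> D" for q
    using NP_Delta_u_function [OF has_vector_derivative_mult_left [OF a [OF U [OF that]], of 2]]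
    by (simp_all add: \<beta>_def a'_def)
  have key: "Re (A' (fst (snd p))) = 0" "A'' (fst (snd p)) = 0" if p: "p \<in> D" for p
  proof -
    have germ: thesis if *: "\<And>E. open E \<Longrightarrow> p \<in> E \<Longrightarrow> E \<subseteq> D \<Longrightarrow>
        (\<And>q. q \<in> E \<Longrightarrow> NP_Delta l (\<lambda>q. k q $ 4) q = 2 * of_real (Re (\<beta> q)) * k q $ 4) \<Longrightarrow>
        (\<forall>q\<in>E. NP_gamma g k l m q = \<beta> q) \<or> (\<forall>q\<in>E. NP_gamma g k l m q = cnj (\<beta> q)) \<Longrightarrow> thesis"
      for thesis
      by (rule NP_gamma_eq_log_derivative [OF assms(6,7), where \<beta> = \<beta> and p = p])
         (use assms(8) Fzz_diff Fzz_Delta p * in \<open>auto simp: case_prod_unfold\<close>)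
    obtain E where E: "open E" "p \<in> E" "E \<subseteq> D"
      and kE: "NP_Delta l (\<lambda>q. k q $ 4) p = 2 * of_real (Re (\<beta> p)) * k p $ 4"
      and gE: "(\<forall>q\<in>E. NP_gamma g k l m q = \<beta> q) \<or> (\<forall>q\<in>E. NP_gamma g k l m q = cnj (\<beta> q))"
      by (rule germ) auto
    have kl: "k p $ 4 \<noteq> 0" "l p $ 3 \<noteq> 0"
      using comp(3) [OF p] by auto
    \<comment> \<open>Both alternatives for \<gamma> have the same real part.\<close>
    have "Re (\<beta> p) = 0"
      using gE E(2) bspec [OF assms(10) p] by auto
    moreover have "Im (l p $ 3) = 0"
      using comp(5) [OF p] by (simp add: complex_eq_iff)
    ultimately show "Re (A' (fst (snd p))) = 0"
      using kl(2) by (auto simp: \<beta>_def complex_eq_iff)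
    \<comment> \<open>The product is constantly \<open>1\<close> on \<open>D\<close>. Since \<Delta>
      annihilates \<open>k $ 4\<close> at \<open>p\<close> by \<open>kE\<close>, it annihilates
      \<open>l $ 3\<close> there too, leaving only \<open>A''\<close> in the derivative of
      \<beta>.\<close>
    have "NP_Delta l (\<lambda>q. k q $ 4 * l q $ 3) p = 0"
      by (rule trans [OF NP_Delta_cong [OF assms(1) p comp(3)] NP_Delta_const])
    then have l0: "NP_Delta l (\<lambda>q. l q $ 3) p = 0"
      unfolding NP_Delta_mult [OF diff(1) [OF p] diff(2) [OF p]] using kE \<open>Re (\<beta> p) = 0\<close> kl by simp
    note A'u = NP_Delta_u_function [OF A' [OF U [OF p]]]
    have \<beta>_diff: "\<beta> differentiable (at p)"
      unfolding \<beta>_def [abs_def] by (intro differentiable_mult diff(2) p A'u)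
    have \<beta>_Delta: "NP_Delta l \<beta> p = l p $ 3 * (l p $ 3 * A'' (fst (snd p)))"
      unfolding \<beta>_def [abs_def] NP_Delta_mult [OF diff(2) [OF p] A'u(1)] A'u(2) l0 by simp
    \<comment> \<open>The alternative holds on all of the open set \<open>E\<close>, so it may be
      differentiated; \<Delta> is real, so conjugation does not matter.\<close>
    have "NP_Delta l \<beta> p = 0"
      using gE
    proof
      assume "\<forall>q\<in>E. NP_gamma g k l m q = \<beta> q"
      then have "NP_Delta l (NP_gamma g k l m) p = NP_Delta l \<beta> p"
        by (intro NP_Delta_cong [OF E(1,2)]) auto
      then show ?thesis using assms(9) p by simp
    next
      assume "\<forall>q\<in>E. NP_gamma g k l m q = cnj (\<beta> q)"
      then have "NP_Delta l (NP_gamma g k l m) p = NP_Delta l (\<lambda>q. cnj (\<beta> q)) p"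
        by (intro NP_Delta_cong [OF E(1,2)]) auto
      also have "\<dots> = cnj (NP_Delta l \<beta> p)"
        by (rule NP_Delta_cnj [where l = l and p = p, OF \<beta>_diff comp(6) [OF p]])
      finally show ?thesis using assms(9) p by simp
    qed
    then show "A'' (fst (snd p)) = 0"
      using kl(2) \<beta>_Delta by simp
  qed
  have "\<exists>p\<in>D. fst (snd p) = u" if "u \<in> ?U" for u
    using that by (auto simp: u_range_def case_prod_unfold)
  then have "Re (A' u) = 0" "(A' has_vector_derivative 0) (at u)" if "u \<in> ?U" for u
    using key A' [OF that] that by metis+
  then obtain A0 r where "\<And>u. u \<in> ?U \<Longrightarrow> A u = A0 + \<i> * of_real (r * u)"
    using affine_if_derivative_constant [OF connected_u_range [OF assms(2)] A]
    by metis
  then show ?thesis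
    unfolding assms(5) by (rule linear_exponent_pp_equivalent)
qed

end
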